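(* Let $1\le s\le r$ be integers, let $b_1<b_2<\dots<b_r$ be points of $\mathbb{R}_+$, and let $\nu=\frac1r\sum_{j=1}^r\delta_{b_j}$. Let $b_{j_1},\dots,b_{j_s}$ be a subset of size $s$ chosen uniformly at random among the $\binom{r}{s}$ subsets of size $s$, let $\mu=\frac1r\sum_{i=1}^s\delta_{b_{j_i}}$, and let $\mathbb{P}_{r,s}$ denote the resulting uniform probability measure on the set of such $\mu$. Assume $\varphi:\mathbb{R}_+\to\mathbb{R}$ is a bounded measurable function. Then for every $\varepsilon>0$ $$\mathbb{P}_{r,s}\left(\mu:\ \left|\langle\mu,\varphi\rangle-\frac{s}{r}\langle\nu,\varphi\rangle\right|>\varepsilon\right)\le 2\exp\left(-\frac{r\varepsilon^2}{64\|\varphi\|_\infty^2}\right).$$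
   Context: $\langle\mu,\varphi\rangle=\int\varphi\,d\mu$ and $\|\varphi\|_\infty=\sup_x|\varphi(x)|$. Note that both $\mu$ and $\nu$ are normalized by $1/r$. *)

theory Defs
  imports "HOL-Probability.Probability"
begin

abbreviation half_line :: "real measure" where
  "half_line \<equiv> restrict_space borel {0..}"

text \<open>The measure \<open>(1/r) \<Sum>\<^sub>j\<^sub>\<in>\<^sub>J \<delta>\<^bsub>b j\<^esub>\<close> on the half-line. The factor is \<open>1/r\<close> whatever the size
  of \<open>J\<close>, so the total mass is \<open>card J / r\<close>.\<close>

definition atomic_measure :: "nat \<Rightarrow> (nat \<Rightarrow> real) \<Rightarrow> nat set \<Rightarrow> real measure" where
  "atomic_measure r b J = measure_of (space half_line) (sets half_line)
     (\<lambda>A. ennreal (1 / real r) * (\<Sum>j\<in>J. emeasure (return half_line (b j)) A))"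

lemma sets_atomic_measure [simp, measurable_cong]: "sets (atomic_measure r b J) = sets half_line"
  unfolding atomic_measure_def by (rule sets.sets_measure_of_eq)

lemma space_atomic_measure [simp]: "space (atomic_measure r b J) = {0..}"
  using sets_eq_imp_space_eq[OF sets_atomic_measure] by (simp add: space_restrict_space)

text \<open>The set function in the definition is a measure, so \<open>measure_of\<close> does not fall back to
  the null measure.\<close>

lemma emeasure_atomic_measure:
  assumes "A \<in> sets half_line"
  shows "emeasure (atomic_measure r b J) A =
    ennreal (1 / real r) * (\<Sum>j\<in>J. emeasure (return half_line (b j)) A)"
proof (rule emeasure_measure_of[OF atomic_measure_def])
  show "sets half_line \<subseteq> Pow (space half_line)" by (rule sets.space_closed)
  show "A \<in> sets (atomic_measure r b J)" using assms by simp
  show "positive (sets (atomic_measure r b J))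
      (\<lambda>A. ennreal (1 / real r) * (\<Sum>j\<in>J. emeasure (return half_line (b j)) A))"
    by (simp add: positive_def)
  show "countably_additive (sets (atomic_measure r b J))
      (\<lambda>A. ennreal (1 / real r) * (\<Sum>j\<in>J. emeasure (return half_line (b j)) A))"
  proof (rule countably_additiveI)
    fix F :: "nat \<Rightarrow> real set"
    assume F: "range F \<subseteq> sets (atomic_measure r b J)" "disjoint_family F"
    have "(\<Sum>i. \<Sum>j\<in>J. emeasure (return half_line (b j)) (F i))
        = (\<Sum>j\<in>J. \<Sum>i. emeasure (return half_line (b j)) (F i))"
      by (rule suminf_sum) simp
    also have "\<dots> = (\<Sum>j\<in>J. emeasure (return half_line (b j)) (\<Union>i. F i))"
      using F by (intro sum.cong refl suminf_emeasure) auto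
    finally show "(\<Sum>i. ennreal (1 / real r) * (\<Sum>j\<in>J. emeasure (return half_line (b j)) (F i)))
        = ennreal (1 / real r) * (\<Sum>j\<in>J. emeasure (return half_line (b j)) (\<Union>i. F i))"
      by (simp add: ennreal_suminf_cmult)
  qed
qed

text \<open>The law of the random measure obtained from a uniformly chosen \<open>s\<close>-element set of indices
  (equivalently, of points, as \<open>b\<close> will be injective on \<open>{1..r}\<close>).\<close>

definition random_submeasure :: "nat \<Rightarrow> nat \<Rightarrow> (nat \<Rightarrow> real) \<Rightarrow> real measure pmf" where
  "random_submeasure r s b =
     map_pmf (atomic_measure r b) (pmf_of_set {J. J \<subseteq> {1..r} \<and> card J = s})"

definition half_line_sup_norm :: "(real \<Rightarrow> real) \<Rightarrow> real" where
  "half_line_sup_norm \<phi> = (SUP x\<in>{0..}. \<bar>\<phi> x\<bar>)"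

end

theory Submission
  imports Defs
begin

text \<open>
  With \<open>x j = \<phi> (b j)\<close> the integrals are \<open>1/r\<close> times sums of \<open>x\<close>, so the
  statement concerns the sum of \<open>x\<close> over a uniformly random \<open>s\<close>-element subset \<open>J\<close> of
  \<open>{1..r}\<close>: this sum should rarely be further than \<open>r \<epsilon>\<close> from its mean \<open>s m\<close>, where \<open>m\<close> is
  the average of all the \<open>x j\<close>. The numbers \<open>x j\<close> lie in \<open>[-M, M]\<close> for the supremum norm \<open>M\<close>.

  The elements of \<open>J\<close> are not independent, but the moment generating function of the sum is
  still bounded by that of \<open>s\<close> independent draws in Hoeffding's inequality,
  \<open>exp (t s m + s t\<^sup>2 (2 M)\<^sup>2 / 8)\<close> (lemma \<open>subset_sum_mgf_le\<close>). The proof is by induction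
  on \<open>s\<close>: draw one element \<open>i\<close> first. The remaining ones form a uniform subset of a population
  whose average is an affine function of \<open>x i\<close>, and drawing a large \<open>x i\<close> lowers that average.
  The total exponent is therefore affine in \<open>x i\<close> with a slope in \<open>[0, 1]\<close>: the dependence only
  shrinks the range to which Hoeffding's lemma for the single draw \<open>i\<close> is applied.

  The optimal Chernoff bound on both tails then gives \<open>2 exp (- d\<^sup>2 / (2 s M\<^sup>2))\<close> for
  deviations of size \<open>d\<close> (lemma \<open>subset_sum_deviation_le\<close>). For \<open>d = r \<epsilon>\<close> and \<open>s \<le> r\<close> this is
  at most \<open>2 exp (- r \<epsilon>\<^sup>2 / (2 M\<^sup>2))\<close>, which leaves a factor \<open>32\<close> to spare in the exponent.
\<close>

section \<open>Sampling without replacement\<close>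

text \<open>Each set of size \<open>s + 1\<close> arises from \<open>s + 1\<close> choices of a first element \<open>i\<close>. This is the
  counting form of the fact that a uniform subset can be drawn one element at a time.\<close>

lemma sum_over_marked_subsets:
  fixes f :: "'a set \<Rightarrow> real"
  assumes "finite A"
  shows "(\<Sum>i\<in>A. \<Sum>J | J \<subseteq> A - {i} \<and> card J = s. f (insert i J))
    = real (Suc s) * (\<Sum>J | J \<subseteq> A \<and> card J = Suc s. f J)"
proof -
  have fin: "J \<subseteq> A \<Longrightarrow> finite J" for J
    using assms by (rule rev_finite_subset)
  have "(\<Sum>i\<in>A. \<Sum>J | J \<subseteq> A - {i} \<and> card J = s. f (insert i J))
      = (\<Sum>(i, J)\<in>(SIGMA i:A. {J. J \<subseteq> A - {i} \<and> card J = s}). f (insert i J))"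
    using assms by (intro sum.Sigma) auto
  also have "\<dots> = (\<Sum>(J, i)\<in>(SIGMA J:{J. J \<subseteq> A \<and> card J = Suc s}. J). f J)"
    by (rule sum.reindex_bij_witness[where i = "\<lambda>(J, i). (i, J - {i})" and j = "\<lambda>(i, J). (insert i J, i)"])
      (auto simp: insert_absorb card_insert_if fin card_Diff_singleton dest: subset_Diff_insert[THEN iffD1])
  also have "\<dots> = (\<Sum>J | J \<subseteq> A \<and> card J = Suc s. \<Sum>i\<in>J. f J)"
    using assms fin by (intro sum.Sigma[symmetric]) auto
  also have "\<dots> = real (Suc s) * (\<Sum>J | J \<subseteq> A \<and> card J = Suc s. f J)"
    unfolding sum_distrib_left by (intro sum.cong) auto
  finally show ?thesis .
qed

lemma Hoeffdings_lemma_finite_average: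
  fixes y :: "'a \<Rightarrow> real"
  assumes "finite A" "A \<noteq> {}" "\<And>i. i \<in> A \<Longrightarrow> l \<le> y i \<and> y i \<le> u" "0 < t"
  shows "(\<Sum>i\<in>A. exp (t * y i))
    \<le> real (card A) * exp (t * (sum y A / real (card A)) + t\<^sup>2 * (u - l)\<^sup>2 / 8)"
proof -
  interpret interval_bounded_random_variable "measure_pmf (pmf_of_set A)" y l u
    using assms by unfold_locales (auto simp: AE_measure_pmf_iff)
  define m where "m = sum y A / real (card A)"
  have E: "measure_pmf.expectation (pmf_of_set A) y = m"
    using assms by (simp add: integral_pmf_of_set m_def)
  have "ennreal ((\<Sum>i\<in>A. exp (t * (y i - m))) / card A)
      = (\<integral>\<^sup>+ i. ennreal (exp (t * (y i - m))) \<partial>measure_pmf (pmf_of_set A))"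
    using assms by (subst nn_integral_pmf_of_set)
      (auto simp: sum_nonneg divide_ennreal sum_ennreal ennreal_of_nat_eq_real_of_nat card_gt_0_iff)
  also have "\<dots> \<le> ennreal (exp (t\<^sup>2 * (u - l)\<^sup>2 / 8))"
    using Hoeffdings_lemma_nn_integral[OF \<open>0 < t\<close>] by (simp add: E)
  finally have *: "(\<Sum>i\<in>A. exp (t * (y i - m))) / card A \<le> exp (t\<^sup>2 * (u - l)\<^sup>2 / 8)"
    by simp
  have "(\<Sum>i\<in>A. exp (t * y i)) = exp (t * m) * (\<Sum>i\<in>A. exp (t * (y i - m)))"
    by (simp add: sum_distrib_left algebra_simps flip: exp_add)
  also have "\<dots> \<le> exp (t * m) * (card A * exp (t\<^sup>2 * (u - l)\<^sup>2 / 8))"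
    using * assms by (intro mult_left_mono) (auto simp: field_simps card_gt_0_iff)
  finally show ?thesis
    by (simp add: m_def exp_add mult_ac)
qed

text \<open>Hoeffding's bound on the moment generating function of a sample without replacement,
  multiplied by the number of samples so that the induction needs only finite sums. With \<open>n = card A\<close>
  and \<open>R\<close> the sum of \<open>x\<close> over \<open>A\<close>, drawing \<open>i\<close> first leaves a population of average
  \<open>(R - x i) / (n - 1)\<close>. The induction hypothesis for the other \<open>s\<close> draws therefore produces the
  exponent \<open>t y i\<close> with \<open>y i = x i + s (R - x i) / (n - 1)\<close>. This \<open>y\<close> is affine in \<open>x\<close>
  with slope \<open>a = 1 - s / (n - 1)\<close> between 0 and 1, and its average is \<open>(s + 1) R / n\<close>, the mean
  of the whole sample.\<close>

lemma subset_sum_mgf_le: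
  fixes x :: "'a \<Rightarrow> real"
  assumes "finite A" "s \<le> card A" "\<And>i. i \<in> A \<Longrightarrow> l \<le> x i \<and> x i \<le> u" "0 < t"
  shows "(\<Sum>J | J \<subseteq> A \<and> card J = s. exp (t * sum x J))
    \<le> real (card A choose s)
      * exp (t * (real s * (sum x A / real (card A))) + real s * (t\<^sup>2 * (u - l)\<^sup>2 / 8))"
  using assms
proof (induction s arbitrary: A)
  case 0
  have "{J. J \<subseteq> A \<and> card J = 0} = {{}}"
    using finite_subset[OF _ \<open>finite A\<close>] by auto
  thus ?case by simp
next
  case (Suc s)
  define n where "n = card A"
  define R where "R = sum x A"
  define c where "c = t\<^sup>2 * (u - l)\<^sup>2 / 8"
  (* For n = 1 (hence s = 0) the denominators vanish; division by zero then gives a = 1 and k = 0,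
     so that y = x, as it should be when nothing remains to be drawn. *)
  define a where "a = 1 - real s / (real n - 1)"
  define k where "k = real s * R / (real n - 1)"
  define y where "y i = a * x i + k" for i
  have n: "Suc s \<le> n" using Suc.prems by (simp add: n_def)
  have A: "A \<noteq> {}" using n by (auto simp: n_def)
  have lu: "l \<le> u" using A Suc.prems(3) by force
  have a: "0 \<le> a" "a \<le> 1" using n by (auto simp: a_def divide_simps)
  have mean: "sum y A / real n = real (Suc s) * (R / real n)"
  proof -
    have "sum y A = a * R + real n * k"
      by (simp add: y_def sum.distrib n_def R_def sum_distrib_left)
    moreover have "a * R + real n * k = real (Suc s) * R"
    proof (cases "n = 1")
      case True thus ?thesis using n by (simp add: a_def k_def)
    next
      case False
      with n have "real n = (real n - 1) + 1" "real n - 1 \<noteq> 0" by auto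
      then obtain p where "real n = p + 1" "p \<noteq> 0" by blast
      thus ?thesis by (simp add: a_def k_def field_simps)
    qed
    ultimately show ?thesis by simp
  qed
  have step: "(\<Sum>J | J \<subseteq> A - {i} \<and> card J = s. exp (t * sum x (insert i J)))
      \<le> real (n - 1 choose s) * exp (real s * c) * exp (t * y i)" if i: "i \<in> A" for i
  proof -
    have card: "card (A - {i}) = n - 1" and sum: "sum x (A - {i}) = R - x i"
      using i Suc.prems by (auto simp: n_def R_def sum_diff1)
    have "(\<Sum>J | J \<subseteq> A - {i} \<and> card J = s. exp (t * sum x (insert i J)))
        = (\<Sum>J | J \<subseteq> A - {i} \<and> card J = s. exp (t * x i) * exp (t * sum x J))"
    proof (intro sum.cong refl)
      fix J assume "J \<in> {J. J \<subseteq> A - {i} \<and> card J = s}"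
      hence "finite J" "i \<notin> J" using Suc.prems(1) finite_subset by auto
      thus "exp (t * sum x (insert i J)) = exp (t * x i) * exp (t * sum x J)"
        by (simp add: distrib_left exp_add)
    qed
    also have "\<dots> = exp (t * x i) * (\<Sum>J | J \<subseteq> A - {i} \<and> card J = s. exp (t * sum x J))"
      by (rule sum_distrib_left[symmetric])
    also have "\<dots> \<le> exp (t * x i) * (real (n - 1 choose s)
        * exp (t * (real s * ((R - x i) / real (n - 1))) + real s * c))"
      using Suc.IH[of "A - {i}"] Suc.prems n card sum
      by (intro mult_left_mono) (auto simp: c_def)
    also have "\<dots> = real (n - 1 choose s) * exp (real s * c)
        * exp (t * (x i + real s * ((R - x i) / real (n - 1))))"
      by (simp add: exp_add distrib_left)
    also have "x i + real s * ((R - x i) / real (n - 1)) = y i"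
      using n by (simp add: y_def a_def k_def of_nat_diff diff_divide_distrib algebra_simps)
    finally show ?thesis .
  qed
  have Hoeff: "(\<Sum>i\<in>A. exp (t * y i)) \<le> real n * exp (t * (real (Suc s) * (R / real n)) + c)"
  proof -
    have "(\<Sum>i\<in>A. exp (t * y i))
        \<le> real n * exp (t * (sum y A / real n) + t\<^sup>2 * ((a * u + k) - (a * l + k))\<^sup>2 / 8)"
      unfolding n_def using Suc.prems A a
      by (intro Hoeffdings_lemma_finite_average) (auto simp: y_def mult_left_mono)
    moreover have "((a * u + k) - (a * l + k))\<^sup>2 \<le> (u - l)\<^sup>2"
      using a lu by (intro power_mono) (auto simp: mult_left_le_one_le mult_left_mono simp flip: right_diff_distrib)
    ultimately show ?thesis
      unfolding mean c_def
      by (elim order_trans) (auto intro!: mult_left_mono divide_right_mono)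
  qed
  have "real (Suc s) * (\<Sum>J | J \<subseteq> A \<and> card J = Suc s. exp (t * sum x J))
      = (\<Sum>i\<in>A. \<Sum>J | J \<subseteq> A - {i} \<and> card J = s. exp (t * sum x (insert i J)))"
    by (rule sum_over_marked_subsets[OF Suc.prems(1), symmetric])
  also have "\<dots> \<le> real (n - 1 choose s) * exp (real s * c) * (\<Sum>i\<in>A. exp (t * y i))"
    by (subst sum_distrib_left) (intro sum_mono step)
  also have "\<dots> \<le> real (n - 1 choose s) * exp (real s * c)
      * (real n * exp (t * (real (Suc s) * (R / real n)) + c))"
    by (intro mult_left_mono Hoeff) auto
  also have "\<dots> = real (n * (n - 1 choose s)) * exp (t * (real (Suc s) * (R / real n)) + real (Suc s) * c)"
    by (simp add: exp_add distrib_right)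
  also have "n * (n - 1 choose s) = Suc s * (n choose Suc s)"
    using Suc_times_binomial_eq[of "n - 1" s] n by (simp add: mult.commute)
  finally show ?case
    unfolding n_def R_def c_def of_nat_mult mult.assoc by (rule mult_left_le_imp_le) simp
qed

text \<open>The Chernoff bound obtained from the moment generating function. It has the same form as
  Hoeffding's inequality for \<open>s\<close> independent draws from \<open>[l, u]\<close>.\<close>

lemma subset_sum_tail_le:
  fixes x :: "'a \<Rightarrow> real"
  assumes "finite A" "1 \<le> s" "s \<le> card A" "\<And>i. i \<in> A \<Longrightarrow> l \<le> x i \<and> x i \<le> u" "l < u" "0 < d"
  shows "measure_pmf.prob (pmf_of_set {J. J \<subseteq> A \<and> card J = s})
      {J. d \<le> sum x J - real s * (sum x A / real (card A))}
    \<le> exp (- (2 * d\<^sup>2 / (real s * (u - l)\<^sup>2)))"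
proof -
  define S where "S = {J. J \<subseteq> A \<and> card J = s}"
  define m where "m = real s * (sum x A / real (card A))"
  define V where "V = real s * (u - l)\<^sup>2"
  (* this t minimizes the exponent t^2 V / 8 - t d of the Chernoff bound *)
  define t where "t = 4 * d / V"
  have V: "0 < V" using assms by (simp add: V_def)
  have t: "0 < t" using V assms by (simp add: t_def)
  have S: "finite S" "card S = card A choose s"
    using assms by (auto simp: S_def n_subsets)
  have S0: "0 < real (card S)" using S assms by simp
  hence Sne: "S \<noteq> {}" by auto
  have "real (card (S \<inter> {J. d \<le> sum x J - m})) = (\<Sum>J\<in>S. indicator {J. d \<le> sum x J - m} J)"
    using S by (simp add: indicator_def)
  also have "\<dots> \<le> (\<Sum>J\<in>S. exp (- t * (m + d)) * exp (t * sum x J))"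
  proof (rule sum_mono)
    fix J
    have "0 \<le> t * (sum x J - m - d)" if "d \<le> sum x J - m" using that t by simp
    thus "indicator {J. d \<le> sum x J - m} J \<le> exp (- t * (m + d)) * exp (t * sum x J)"
      by (auto simp: indicator_def algebra_simps simp flip: exp_add)
  qed
  also have "\<dots> \<le> exp (- t * (m + d))
      * (real (card S) * exp (t * m + real s * (t\<^sup>2 * (u - l)\<^sup>2 / 8)))"
    unfolding sum_distrib_left[symmetric] m_def S(2) unfolding S_def
    using assms t by (intro mult_left_mono subset_sum_mgf_le) auto
  also have "\<dots> = real (card S) * exp (t\<^sup>2 * V / 8 - t * d)"
    by (simp add: V_def algebra_simps flip: exp_add)
  also have "t\<^sup>2 * V / 8 - t * d = - (2 * d\<^sup>2 / V)"
    using V unfolding t_def by (simp add: field_simps power2_eq_square)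
  finally have "measure_pmf.prob (pmf_of_set S) {J. d \<le> sum x J - m} \<le> exp (- (2 * d\<^sup>2 / V))"
    using S0 by (simp add: measure_pmf_of_set[OF Sne S(1)] divide_le_eq mult.commute)
  thus ?thesis
    unfolding S_def m_def V_def .
qed

lemma subset_sum_deviation_le:
  fixes x :: "'a \<Rightarrow> real"
  assumes "finite A" "1 \<le> s" "s \<le> card A" "\<And>i. i \<in> A \<Longrightarrow> \<bar>x i\<bar> \<le> M" "0 < M" "0 < d"
  shows "measure_pmf.prob (pmf_of_set {J. J \<subseteq> A \<and> card J = s})
      {J. d \<le> \<bar>sum x J - real s * (sum x A / real (card A))\<bar>}
    \<le> 2 * exp (- (d\<^sup>2 / (2 * real s * M\<^sup>2)))"
proof -
  let ?p = "pmf_of_set {J. J \<subseteq> A \<and> card J = s}"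
  let ?D = "\<lambda>x J. sum x J - real s * (sum x A / real (card A))"
  have tail: "measure_pmf.prob ?p {J. d \<le> ?D z J} \<le> exp (- (d\<^sup>2 / (2 * real s * M\<^sup>2)))"
    if "\<And>i. i \<in> A \<Longrightarrow> \<bar>z i\<bar> \<le> M" for z :: "'a \<Rightarrow> real"
    using subset_sum_tail_le[of A s "- M" z M d] that assms
    by (simp add: abs_le_iff minus_le_iff power_mult_distrib mult.assoc flip: mult_2)
  (* the lower tail of x is the upper tail of -x *)
  have "{J. d \<le> \<bar>?D x J\<bar>} = {J. d \<le> ?D x J} \<union> {J. d \<le> ?D (\<lambda>i. - x i) J}"
    by (auto simp: sum_negf abs_if)
  hence "measure_pmf.prob ?p {J. d \<le> \<bar>?D x J\<bar>}
      \<le> measure_pmf.prob ?p {J. d \<le> ?D x J} + measure_pmf.prob ?p {J. d \<le> ?D (\<lambda>i. - x i) J}"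
    by (simp add: measure_Un_le)
  thus ?thesis
    using tail[of x] tail[of "\<lambda>i. - x i"] assms(4) by fastforce
qed

section \<open>Integrals against the atomic measures\<close>

text \<open>Seen as the image of a weighted counting measure on the indices, an atomic measure has the
  standard change-of-variables formula for its integrals.\<close>

lemma atomic_measure_eq_distr:
  assumes "finite J" "\<And>j. j \<in> J \<Longrightarrow> 0 \<le> b j"
  shows "atomic_measure r b J = distr (point_measure J (\<lambda>_. ennreal (1 / real r))) half_line b"
proof (rule measure_eqI)
  fix A assume "A \<in> sets (atomic_measure r b J)"
  hence A: "A \<in> sets half_line" by simp
  have "emeasure (distr (point_measure J (\<lambda>_. ennreal (1 / real r))) half_line b) A
      = (\<Sum>j\<in>b -` A \<inter> J. ennreal (1 / real r))"
    using assms A by (subst emeasure_distr)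
      (auto simp: space_restrict_space space_point_measure emeasure_point_measure_finite)
  also have "\<dots> = ennreal (1 / real r) * (\<Sum>j\<in>J. indicator A (b j))"
    using assms(1) unfolding Int_commute[of _ J] sum_distrib_left
    by (subst sum.inter_restrict) (assumption, intro sum.cong, auto)
  also have "\<dots> = emeasure (atomic_measure r b J) A"
    using A by (simp add: emeasure_atomic_measure emeasure_return)
  finally show "emeasure (atomic_measure r b J) A
      = emeasure (distr (point_measure J (\<lambda>_. ennreal (1 / real r))) half_line b) A" ..
qed simp

lemma integral_atomic_measure:
  fixes \<phi> :: "real \<Rightarrow> real"
  assumes "finite J" "\<And>j. j \<in> J \<Longrightarrow> 0 \<le> b j" "\<phi> \<in> borel_measurable half_line"
  shows "(\<integral>x. \<phi> x \<partial>atomic_measure r b J) = (\<Sum>j\<in>J. \<phi> (b j)) / real r"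
proof -
  have "(\<integral>x. \<phi> x \<partial>atomic_measure r b J)
      = (\<integral>j. \<phi> (b j) \<partial>point_measure J (\<lambda>_. ennreal (1 / real r)))"
    using assms by (subst atomic_measure_eq_distr)
      (auto intro!: integral_distr simp: space_restrict_space)
  also have "\<dots> = (\<Sum>j\<in>J. \<phi> (b j)) / real r"
    using assms(1) by (simp add: lebesgue_integral_point_measure_finite sum_divide_distrib)
  finally show ?thesis .
qed

section \<open>The concentration inequality\<close>

lemma abs_le_half_line_sup_norm:
  assumes "bounded (\<phi> ` {0..})" "0 \<le> x"
  shows "\<bar>\<phi> x\<bar> \<le> half_line_sup_norm \<phi>"
proof -
  have "bdd_above ((\<lambda>x. \<bar>\<phi> x\<bar>) ` {0..})"
    using assms(1) by (auto simp: bounded_iff bdd_above_def)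
  thus ?thesis
    using assms(2) unfolding half_line_sup_norm_def by (intro cSUP_upper) auto
qed

theorem theorem5:
  fixes r s :: nat and b :: "nat \<Rightarrow> real" and \<phi> :: "real \<Rightarrow> real" and \<epsilon> :: real
  assumes "1 \<le> s" and "s \<le> r"
    and "strict_mono_on {1..r} b"
    and "\<And>j. j \<in> {1..r} \<Longrightarrow> 0 \<le> b j"
    and "\<phi> \<in> borel_measurable half_line"
    and "bounded (\<phi> ` {0..})"
    and "\<epsilon> > 0"
  shows "measure_pmf.prob (random_submeasure r s b)
      {\<mu>. \<bar>(\<integral>x. \<phi> x \<partial>\<mu>) - real s / real r * (\<integral>x. \<phi> x \<partial>atomic_measure r b {1..r})\<bar> > \<epsilon>}
    \<le> (if half_line_sup_norm \<phi> = 0 then 0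
       else 2 * exp (- (real r * \<epsilon>\<^sup>2 / (64 * (half_line_sup_norm \<phi>)\<^sup>2))))"
proof -
  define S where "S = {J. J \<subseteq> {1..r} \<and> card J = s}"
  define M where "M = half_line_sup_norm \<phi>"
  define x where "x j = \<phi> (b j)" for j
  define D where "D J = sum x J - real s * (sum x {1..r} / real r)" for J
  have r: "0 < real r" using assms by simp
  have x: "\<bar>x j\<bar> \<le> M" if "j \<in> {1..r}" for j
    unfolding x_def M_def using that assms by (intro abs_le_half_line_sup_norm) auto
  have "0 < card S"
    using assms(2) by (simp add: S_def n_subsets)
  hence S: "finite S" "S \<noteq> {}"
    by (simp_all add: card_gt_0_iff)
  have int: "(\<integral>x. \<phi> x \<partial>atomic_measure r b J) = sum x J / real r" if "J \<subseteq> {1..r}" for J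
    unfolding x_def using that assms by (intro integral_atomic_measure) (auto intro: finite_subset)
  have "measure_pmf.prob (random_submeasure r s b)
      {\<mu>. \<bar>(\<integral>x. \<phi> x \<partial>\<mu>) - real s / real r * (\<integral>x. \<phi> x \<partial>atomic_measure r b {1..r})\<bar> > \<epsilon>}
    = measure_pmf.prob (pmf_of_set S) {J. \<bar>(\<integral>x. \<phi> x \<partial>atomic_measure r b J)
        - real s / real r * (\<integral>x. \<phi> x \<partial>atomic_measure r b {1..r})\<bar> > \<epsilon>}"
    by (simp add: random_submeasure_def S_def vimage_def)
  also have "\<dots> \<le> measure_pmf.prob (pmf_of_set S) {J. real r * \<epsilon> < \<bar>D J\<bar>}"
  proof (rule measure_pmf.finite_measure_mono_AE)
    have "real r * \<epsilon> < \<bar>D J\<bar>" if "J \<in> S" and *: "\<bar>(\<integral>x. \<phi> x \<partial>atomic_measure r b J)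
        - real s / real r * (\<integral>x. \<phi> x \<partial>atomic_measure r b {1..r})\<bar> > \<epsilon>" for J
    proof -
      have "(\<integral>x. \<phi> x \<partial>atomic_measure r b J)
          - real s / real r * (\<integral>x. \<phi> x \<partial>atomic_measure r b {1..r}) = D J / real r"
        using that(1) r by (simp add: S_def int D_def diff_divide_distrib)
      with * r show ?thesis by (simp add: field_simps)
    qed
    thus "AE J in measure_pmf (pmf_of_set S). J \<in> {J. \<bar>(\<integral>x. \<phi> x \<partial>atomic_measure r b J)
        - real s / real r * (\<integral>x. \<phi> x \<partial>atomic_measure r b {1..r})\<bar> > \<epsilon>} \<longrightarrow> J \<in> {J. real r * \<epsilon> < \<bar>D J\<bar>}"
      using S by (auto simp: AE_measure_pmf_iff)
  qed simp
  also have "\<dots> \<le> (if M = 0 then 0 else 2 * exp (- (real r * \<epsilon>\<^sup>2 / (64 * M\<^sup>2))))"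
  proof (cases "M = 0")
    case True
    have "sum x J = 0" if "J \<subseteq> {1..r}" for J
      using that x True by (intro sum.neutral) fastforce
    hence "D J = 0" if "J \<in> S" for J
      using that by (simp add: D_def S_def)
    hence "S \<inter> {J. real r * \<epsilon> < \<bar>D J\<bar>} = {}"
      using mult_pos_pos[OF r assms(7)] by auto
    thus ?thesis
      using S True by (simp add: measure_pmf_of_set)
  next
    case False
    have "0 \<le> M" using x[of 1] assms(1,2) by force
    hence M: "0 < M" using False by simp
    have bound: "(real r * \<epsilon>\<^sup>2) / (64 * M\<^sup>2) \<le> (real r * \<epsilon>)\<^sup>2 / (2 * real s * M\<^sup>2)"
    proof -
      have "real s * (real r * \<epsilon>\<^sup>2 * M\<^sup>2) \<le> (32 * real r) * (real r * \<epsilon>\<^sup>2 * M\<^sup>2)"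
        using assms by (intro mult_right_mono) auto
      thus ?thesis
        using M assms(1) by (simp add: field_simps power2_eq_square)
    qed
    have "measure_pmf.prob (pmf_of_set S) {J. real r * \<epsilon> < \<bar>D J\<bar>}
        \<le> measure_pmf.prob (pmf_of_set S) {J. real r * \<epsilon> \<le> \<bar>D J\<bar>}"
      by (intro measure_pmf.finite_measure_mono) auto
    also have "\<dots> \<le> 2 * exp (- ((real r * \<epsilon>)\<^sup>2 / (2 * real s * M\<^sup>2)))"
      using subset_sum_deviation_le[of "{1..r}" s x M "real r * \<epsilon>"] assms x M r
      by (simp add: D_def S_def)
    also have "2 * exp (- ((real r * \<epsilon>)\<^sup>2 / (2 * real s * M\<^sup>2)))
        \<le> 2 * exp (- (real r * \<epsilon>\<^sup>2 / (64 * M\<^sup>2)))" using bound by simp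
    finally show ?thesis using False by simp
  qed
  finally show ?thesis unfolding M_def .
qed

end
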